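(* Let $n_c\ge 2$, $n_v\ge 1$, $N\ge 1$, let $P_{ij}$ ($1\le i\le n_c$, $1\le j\le n_v$) be arbitrary $N\times N$ permutation matrices, and let $H=(P_{ij})$ be the resulting $n_cN\times n_vN$ matrix. For $i\neq j$ in $\{1,\dots,n_c\}$ put $C_{ij}=\sum_{k=1}^{n_v}P_{ik}P_{jk}^{\mathsf T}$ (over $\mathbb Z$), and let $C_H$ be the $n_c\times n_c$ block matrix with zero diagonal blocks and $(i,j)$ block $C_{ij}$ for $i\ne j$. Then $\mathrm{girth}(H)>6$ if and only if $C_H\triangle 0=0$ and $C_HH\triangle H=0$. Equivalently, $\mathrm{girth}(H)>6$ if and only if $$C_{ij}\triangle 0=0\quad\text{and}\quad \Big(\sum_{l=1,\ l\ne i}^{n_c} C_{il}P_{lk}\Big)\triangle P_{ik}=0$$ for all $k\in\{1,\dots,n_v\}$ and all $i,j\in\{1,\dots,n_c\}$ with $i\neq j$.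
   Context: The Tanner graph of a matrix with non-negative integer entries is the bipartite (multi)graph with one check node per row, one variable node per column, and as many edges between check node $a$ and variable node $b$ as the $(a,b)$ entry. $\mathrm{girth}(M)$ is the length of a shortest cycle in the Tanner graph of $M$ ($+\infty$ if there is none). For non-negative integers $e,f$, $e\triangle f:=1$ if $e\ge 2$ and $f=0$, and $e\triangle f:=0$ otherwise; for matrices of equal size, $\triangle$ is applied entrywise. All matrix operations are over $\mathbb Z$. *)

theory Defs
  imports "HOL-Analysis.Analysis" "HOL-Library.Extended_Nat"
begin

(* A multigraph is given by its edge set E and the map taking an edge to its set of end points.
   A cycle visits pairwise distinct vertices along pairwise distinct edges, and edge number i
   joins vertex number i to its cyclic successor.  Two parallel edges form a cycle of length 2. *)
definition multigraph_cycle :: "'e set \<Rightarrow> ('e \<Rightarrow> 'v set) \<Rightarrow> 'v list \<Rightarrow> 'e list \<Rightarrow> bool" where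
  "multigraph_cycle E ends vs es \<longleftrightarrow>
     es \<noteq> [] \<and> length vs = length es \<and> distinct vs \<and> distinct es \<and> set es \<subseteq> E \<and>
     (\<forall>i < length es. ends (es ! i) = {vs ! i, vs ! (Suc i mod length es)})"

(* The infimum of the empty set in enat is infinity, so an acyclic multigraph has girth infinity. *)
definition multigraph_girth :: "'e set \<Rightarrow> ('e \<Rightarrow> 'v set) \<Rightarrow> enat" where
  "multigraph_girth E ends = Inf {enat (length es) | vs es. multigraph_cycle E ends vs es}"

(* The m-th of the M $ a $ b parallel edges between check node a and variable node b is (a, b, m).
   For non-negative entries nat loses nothing. *)
definition tanner_edges :: "int ^ 'v ^ 'c \<Rightarrow> ('c \<times> 'v \<times> nat) set" where
  "tanner_edges M = {(a, b, m). m < nat (M $ a $ b)}"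

(* Check nodes are tagged Inl, variable nodes Inr. *)
definition tanner_ends :: "'c \<times> 'v \<times> nat \<Rightarrow> ('c + 'v) set" where
  "tanner_ends = (\<lambda>(a, b, m). {Inl a, Inr b})"

definition girth :: "int ^ 'v ^ 'c \<Rightarrow> enat" where
  "girth M = multigraph_girth (tanner_edges M) tanner_ends"

definition triangle :: "int \<Rightarrow> int \<Rightarrow> int" where
  "triangle e f = (if e \<ge> 2 \<and> f = 0 then 1 else 0)"

definition mat_triangle :: "int ^ 'v ^ 'c \<Rightarrow> int ^ 'v ^ 'c \<Rightarrow> int ^ 'v ^ 'c" (infix "\<triangle>" 55) where
  "A \<triangle> B = (\<chi> a b. triangle (A $ a $ b) (B $ a $ b))"

definition permutation_matrix :: "int ^ 'n ^ 'n \<Rightarrow> bool" where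
  "permutation_matrix P \<longleftrightarrow> (\<exists>\<pi>. bij \<pi> \<and> P = (\<chi> r s. if s = \<pi> r then 1 else 0))"

(* Rows and columns of a block matrix are indexed by pairs (block index, index inside the block). *)
definition block_matrix :: "('a::finite \<Rightarrow> 'b::finite \<Rightarrow> int ^ 'n::finite ^ 'm::finite) \<Rightarrow> int ^ ('b \<times> 'n) ^ ('a \<times> 'm)" where
  "block_matrix B = (\<chi> x y. B (fst x) (fst y) $ snd x $ snd y)"

definition C_block :: "('c \<Rightarrow> 'v::finite \<Rightarrow> int ^ 'n ^ 'n) \<Rightarrow> 'c \<Rightarrow> 'c \<Rightarrow> int ^ 'n ^ 'n" where
  "C_block P i j = (\<Sum>k\<in>UNIV. P i k ** transpose (P j k))"

definition C_matrix :: "('c::finite \<Rightarrow> 'v::finite \<Rightarrow> int ^ 'n::finite ^ 'n) \<Rightarrow> int ^ ('c \<times> 'n) ^ ('c \<times> 'n)" where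
  "C_matrix P = block_matrix (\<lambda>i j. if i = j then 0 else C_block P i j)"

end

theory Submission
  imports Defs
begin

text \<open>
  All row blocks are permutation matrices, so two distinct check nodes with a common neighbour lie
  in different row blocks. Hence the entries of \<open>C_matrix P\<close> count the paths of length 2 between
  distinct check nodes, and those of \<open>C_matrix P ** H\<close> count the walks \<open>a, y, b, x\<close> with \<open>a \<noteq> b\<close>.
  Two paths of the first kind form a 4-cycle. Two walks of the second kind between non-adjacent
  \<open>a\<close> and \<open>x\<close> form a 6-cycle or contain a 4-cycle; conversely opposite nodes of a 6-cycle are
  joined by two such walks, and if they were adjacent there would be a 4-cycle.
\<close>

section \<open>Cycles of length at most 6 in a Tanner graph\<close>

text \<open>A relation \<open>R\<close> between check and variable nodes replaces edge lists here:
  with 0/1 entries the Tanner graph is simple, so a short cycle is just a pattern of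
  neighbours.\<close>

definition four_cycle :: "('c \<Rightarrow> 'v \<Rightarrow> bool) \<Rightarrow> bool" where
  "four_cycle R \<longleftrightarrow> (\<exists>a b x y. a \<noteq> b \<and> x \<noteq> y \<and> R a x \<and> R b x \<and> R b y \<and> R a y)"

definition six_cycle :: "('c \<Rightarrow> 'v \<Rightarrow> bool) \<Rightarrow> bool" where
  "six_cycle R \<longleftrightarrow> (\<exists>a b c x y z. a \<noteq> b \<and> b \<noteq> c \<and> a \<noteq> c \<and> x \<noteq> y \<and> y \<noteq> z \<and> x \<noteq> z \<and>
     R a x \<and> R b x \<and> R b y \<and> R c y \<and> R c z \<and> R a z)"

text \<open>Symmetric in its two nodes, so that a closed walk may be read from a node of either
  kind.\<close>

fun tanner_adj :: "('c \<Rightarrow> 'v \<Rightarrow> bool) \<Rightarrow> 'c + 'v \<Rightarrow> 'c + 'v \<Rightarrow> bool" where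
  "tanner_adj R (Inl a) (Inr x) = R a x"
| "tanner_adj R (Inr x) (Inl a) = R a x"
| "tanner_adj R (Inl a) (Inl b) = False"
| "tanner_adj R (Inr x) (Inr y) = False"

lemma tanner_adj_isl: "tanner_adj R u v \<Longrightarrow> isl u \<noteq> isl v"
  by (cases u; cases v) auto

lemma closed_walk_4:
  assumes "distinct [p, q, r, s]"
    and "tanner_adj R p q" "tanner_adj R q r" "tanner_adj R r s" "tanner_adj R s p"
  shows "four_cycle R"
  using assms unfolding four_cycle_def
  by (cases p; cases q; cases r; cases s) (simp_all, blast+)

lemma closed_walk_6:
  assumes "distinct [p, q, r, s, t, u]"
    and "tanner_adj R p q" "tanner_adj R q r" "tanner_adj R r s"
    and "tanner_adj R s t" "tanner_adj R t u" "tanner_adj R u p"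
  shows "six_cycle R"
proof (cases p)
  case (Inl a)
  then obtain x b y c z where "q = Inr x" "r = Inl b" "s = Inr y" "t = Inl c" "u = Inr z"
    using assms(2-7) by (cases q; cases r; cases s; cases t; cases u) auto
  with Inl assms show ?thesis unfolding six_cycle_def by simp blast
next
  case (Inr x)
  \<comment> \<open>This walk starts at a variable node; reading it from its second node on gives
    the pattern of \<open>six_cycle\<close>.\<close>
  then obtain a y b z c where "q = Inl a" "r = Inr y" "s = Inl b" "t = Inr z" "u = Inl c"
    using assms(2-7) by (cases q; cases r; cases s; cases t; cases u) auto
  with Inr assms have "R a y \<and> R b y \<and> R b z \<and> R c z \<and> R c x \<and> R a x"
    and "a \<noteq> b \<and> b \<noteq> c \<and> a \<noteq> c \<and> y \<noteq> z \<and> z \<noteq> x \<and> y \<noteq> x" by auto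
  then show ?thesis unfolding six_cycle_def by blast
qed

lemma tanner_edge_zero_one:
  assumes "\<And>a x. M $ a $ x = of_bool (R a x)" and "e \<in> tanner_edges M"
  obtains a x where "e = (a, x, 0)" "R a x" "tanner_ends e = {Inl a, Inr x}"
  using assms by (cases e) (auto simp: tanner_edges_def tanner_ends_def of_bool_def split: if_splits)

lemma tanner_edge_adj:
  assumes "\<And>a x. M $ a $ x = of_bool (R a x)"
    and "e \<in> tanner_edges M" "tanner_ends e = {u, v}"
  shows "tanner_adj R u v"
  using tanner_edge_zero_one[OF assms(1,2)] assms(3) by (metis doubleton_eq_iff tanner_adj.simps(1,2))

text \<open>Entries 0 and 1 leave only edge number 0 between two nodes. This excludes cycles of
  length 2.\<close>

lemma tanner_edge_determined_by_ends:
  assumes "\<And>a x. M $ a $ x = of_bool (R a x)"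
    and "e \<in> tanner_edges M" "f \<in> tanner_edges M" "tanner_ends e = tanner_ends f"
  shows "e = f"
  using tanner_edge_zero_one[OF assms(1,2)] tanner_edge_zero_one[OF assms(1,3)] assms(4)
  by (metis doubleton_eq_iff sum.inject Inl_Inr_False)

text \<open>The two kinds of nodes alternate along a cycle, which excludes lengths 1, 3 and 5.
  Length 2 would need parallel edges, and lengths 4 and 6 give closed walks through distinct
  nodes.\<close>

lemma short_tanner_cycle:
  assumes M: "\<And>a x. M $ a $ x = of_bool (R a x)"
    and cyc: "multigraph_cycle (tanner_edges M) tanner_ends vs es" and len: "length es \<le> 6"
  shows "four_cycle R \<or> six_cycle R"
proof -
  define n where "n = length es"
  have lv: "length vs = n" and dv: "distinct vs" and de: "distinct es" and n0: "n \<noteq> 0"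
    and E: "\<And>i. i < n \<Longrightarrow> es ! i \<in> tanner_edges M"
    and ends: "\<And>i. i < n \<Longrightarrow> tanner_ends (es ! i) = {vs ! i, vs ! (Suc i mod n)}"
    using cyc by (auto simp: multigraph_cycle_def n_def)
  have adj: "tanner_adj R (vs ! i) (vs ! j)" if "i < n" "j = Suc i mod n" for i j
    using tanner_edge_adj[OF M E ends] that by blast
  have ne: "vs ! i \<noteq> vs ! j" if "i < n" "j < n" "i \<noteq> j" for i j
    using that dv lv by (simp add: nth_eq_iff_index_eq)
  have flip: "isl (vs ! i) \<noteq> isl (vs ! j)" if "i < n" "j = Suc i mod n" for i j
    using tanner_adj_isl[OF adj[OF that]] .
  consider "n = 1" | "n = 2" | "n = 3" | "n = 4" | "n = 5" | "n = 6"
    using n0 len unfolding n_def by linarith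
  then show ?thesis
  proof cases
    case 1
    \<comment> \<open>The cyclic successor of the only vertex is that vertex itself.\<close>
    then show ?thesis using flip[of 0 0] by simp
  next
    case 2
    then have "tanner_ends (es ! 0) = tanner_ends (es ! 1)"
      using ends[of 0] ends[of 1] by (simp add: insert_commute)
    then have "es ! 0 = es ! 1"
      using tanner_edge_determined_by_ends[OF M] E 2 by simp
    then show ?thesis using de 2 n_def by (simp add: nth_eq_iff_index_eq)
  next
    case 3
    then show ?thesis using flip[of 0 1] flip[of 1 2] flip[of 2 0] by simp
  next
    case 4
    then have "tanner_adj R (vs ! 0) (vs ! 1)" "tanner_adj R (vs ! 1) (vs ! 2)"
      "tanner_adj R (vs ! 2) (vs ! 3)" "tanner_adj R (vs ! 3) (vs ! 0)"
      by (auto intro!: adj)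
    moreover have "distinct [vs ! 0, vs ! 1, vs ! 2, vs ! 3]"
      using 4 by (simp add: ne)
    ultimately show ?thesis using closed_walk_4 by blast
  next
    case 5
    then show ?thesis using flip[of 0 1] flip[of 1 2] flip[of 2 3] flip[of 3 4] flip[of 4 0] by simp
  next
    case 6
    then have "tanner_adj R (vs ! 0) (vs ! 1)" "tanner_adj R (vs ! 1) (vs ! 2)"
      "tanner_adj R (vs ! 2) (vs ! 3)" "tanner_adj R (vs ! 3) (vs ! 4)"
      "tanner_adj R (vs ! 4) (vs ! 5)" "tanner_adj R (vs ! 5) (vs ! 0)"
      by (auto intro!: adj)
    moreover have "distinct [vs ! 0, vs ! 1, vs ! 2, vs ! 3, vs ! 4, vs ! 5]"
      using 6 by (simp add: ne)
    ultimately show ?thesis using closed_walk_6 by blast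
  qed
qed

lemma four_cycle_tanner_cycle:
  assumes M: "\<And>a x. M $ a $ x = of_bool (R a x)" and "four_cycle R"
  shows "\<exists>vs es. multigraph_cycle (tanner_edges M) tanner_ends vs es \<and> length es = 4"
proof -
  from assms(2) obtain a b x y where "a \<noteq> b" "x \<noteq> y" "R a x" "R b x" "R b y" "R a y"
    unfolding four_cycle_def by blast
  then have "multigraph_cycle (tanner_edges M) tanner_ends [Inl a, Inr x, Inl b, Inr y]
      [(a, x, 0), (b, x, 0), (b, y, 0), (a, y, 0)]"
    by (auto simp: multigraph_cycle_def tanner_edges_def tanner_ends_def M less_Suc_eq)
  then show ?thesis by fastforce
qed

lemma six_cycle_tanner_cycle:
  assumes M: "\<And>a x. M $ a $ x = of_bool (R a x)" and "six_cycle R"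
  shows "\<exists>vs es. multigraph_cycle (tanner_edges M) tanner_ends vs es \<and> length es = 6"
proof -
  from assms(2) obtain a b c x y z
    where "a \<noteq> b" "b \<noteq> c" "a \<noteq> c" "x \<noteq> y" "y \<noteq> z" "x \<noteq> z"
      "R a x" "R b x" "R b y" "R c y" "R c z" "R a z"
    unfolding six_cycle_def by blast
  then have "multigraph_cycle (tanner_edges M) tanner_ends
      [Inl a, Inr x, Inl b, Inr y, Inl c, Inr z]
      [(a, x, 0), (b, x, 0), (b, y, 0), (c, y, 0), (c, z, 0), (a, z, 0)]"
    by (auto simp: multigraph_cycle_def tanner_edges_def tanner_ends_def M less_Suc_eq)
  then show ?thesis by fastforce
qed

text \<open>The strict inequality becomes
  \<open>eSuc (enat k) \<le> multigraph_girth E ends\<close>, and a lower bound of an infimum bounds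
  every member. Acyclic multigraphs are covered, as the infimum is then infinite.\<close>

lemma less_multigraph_girth_iff:
  "enat k < multigraph_girth E ends \<longleftrightarrow> (\<forall>vs es. multigraph_cycle E ends vs es \<longrightarrow> k < length es)"
proof -
  have "enat k < multigraph_girth E ends \<longleftrightarrow> eSuc (enat k) \<le> multigraph_girth E ends"
    by (simp add: eSuc_enat Suc_ile_eq)
  also have "\<dots> \<longleftrightarrow> (\<forall>vs es. multigraph_cycle E ends vs es \<longrightarrow> k < length es)"
    unfolding multigraph_girth_def le_Inf_iff by (fastforce simp: eSuc_enat Suc_le_eq)
  finally show ?thesis .
qed

lemma girth_gt_6_iff:
  assumes "\<And>a x. M $ a $ x = of_bool (R a x)"
  shows "girth M > 6 \<longleftrightarrow> \<not> four_cycle R \<and> \<not> six_cycle R"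
proof -
  have "girth M > 6 \<longleftrightarrow>
      (\<forall>vs es. multigraph_cycle (tanner_edges M) tanner_ends vs es \<longrightarrow> 6 < length es)"
    unfolding girth_def less_multigraph_girth_iff[symmetric] by (simp add: numeral_eq_enat)
  moreover have "\<not> (6::nat) < 4" "\<not> (6::nat) < 6" by simp_all
  ultimately show ?thesis
    using short_tanner_cycle[OF assms] four_cycle_tanner_cycle[OF assms]
      six_cycle_tanner_cycle[OF assms]
    by (metis not_less)
qed

section \<open>Block matrices\<close>

lemma block_matrix_nth: "block_matrix B $ (i, r) $ (j, s) = B i j $ r $ s"
  by (simp add: block_matrix_def)

lemma block_matrix_eq_0_iff: "block_matrix B = 0 \<longleftrightarrow> (\<forall>i j. B i j = 0)"
  by (auto simp: vec_eq_iff block_matrix_nth)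

lemma block_matrix_mat_triangle:
  "block_matrix A \<triangle> block_matrix B = block_matrix (\<lambda>i j. A i j \<triangle> B i j)"
  by (simp add: vec_eq_iff block_matrix_nth mat_triangle_def)

lemma block_matrix_mult:
  "block_matrix A ** block_matrix B = block_matrix (\<lambda>i k. \<Sum>l\<in>UNIV. A i l ** B l k)"
  by (simp add: vec_eq_iff block_matrix_nth matrix_matrix_mult_def sum.cartesian_product
      case_prod_unfold block_matrix_def)

lemma transpose_block_matrix:
  "transpose (block_matrix B) = block_matrix (\<lambda>i j. transpose (B j i))"
  by (simp add: vec_eq_iff block_matrix_nth transpose_def)

lemma zero_mat_triangle [simp]: "0 \<triangle> B = 0"
  by (simp add: vec_eq_iff mat_triangle_def triangle_def)

lemma C_matrix_mat_triangle_0_iff: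
  fixes P :: "'c::finite \<Rightarrow> 'v::finite \<Rightarrow> int ^ 'n::finite ^ 'n"
  shows
  "C_matrix P \<triangle> 0 = 0 \<longleftrightarrow> (\<forall>i j. i \<noteq> j \<longrightarrow> C_block P i j \<triangle> 0 = 0)"
proof -
  have "C_matrix P \<triangle> 0 = block_matrix (\<lambda>i j. (if i = j then 0 else C_block P i j) \<triangle> 0)"
    by (simp add: vec_eq_iff C_matrix_def block_matrix_nth mat_triangle_def)
  then show ?thesis by (auto simp: block_matrix_eq_0_iff)
qed

lemma C_matrix_mult_mat_triangle_iff:
  "(C_matrix P ** block_matrix P) \<triangle> block_matrix P = 0 \<longleftrightarrow>
     (\<forall>i k. (\<Sum>l\<in>UNIV - {i}. C_block P i l ** P l k) \<triangle> P i k = 0)"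
proof -
  \<comment> \<open>The zero diagonal block removes the summand \<open>l = i\<close>.\<close>
  have "(\<Sum>l\<in>UNIV. (if i = l then 0 else C_block P i l) ** P l k) =
      (\<Sum>l\<in>UNIV - {i}. C_block P i l ** P l k)" for i k
    by (rule sum.mono_neutral_cong_right) (auto simp: vec_eq_iff matrix_matrix_mult_def)
  then show ?thesis
    by (simp add: C_matrix_def block_matrix_mult block_matrix_mat_triangle block_matrix_eq_0_iff)
qed

text \<open>Outside the diagonal blocks the entries are inner products of rows of the block matrix,
  the form needed for counting.\<close>

lemma C_matrix_nth:
  "C_matrix P $ a $ b =
     (if fst a = fst b then 0 else (block_matrix P ** transpose (block_matrix P)) $ a $ b)"
  by (cases a; cases b)
    (simp add: C_matrix_def C_block_def block_matrix_nth transpose_block_matrix block_matrix_mult)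

section \<open>Counting paths\<close>

lemma two_le_card_iff:
  "finite S \<Longrightarrow> 2 \<le> card S \<longleftrightarrow> (\<exists>u\<in>S. \<exists>v\<in>S. u \<noteq> v)"
  using card_le_Suc0_iff_eq[of S] by (auto simp: not_less_eq_eq numeral_2_eq_2)

text \<open>An inner product of 0/1 rows counts common neighbours. With the block condition inside
  the set, the zero diagonal blocks become counts of an empty set.\<close>

lemma C_matrix_nth_card:
  assumes "\<And>a x. block_matrix P $ a $ x = of_bool (R a x)"
  shows "C_matrix P $ a $ b = int (card {x. fst a \<noteq> fst b \<and> R a x \<and> R b x})"
  by (simp add: C_matrix_nth matrix_matrix_mult_def transpose_def assms of_bool_conj[symmetric])

lemma C_matrix_mult_nth_card:
  fixes P :: "'c::finite \<Rightarrow> 'v::finite \<Rightarrow> int ^ 'n::finite ^ 'n"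
  assumes "\<And>a x. block_matrix P $ a $ x = of_bool (R a x)"
  shows "(C_matrix P ** block_matrix P) $ a $ x =
    int (card {(b, y). fst a \<noteq> fst b \<and> R a y \<and> R b y \<and> R b x})"
proof -
  have "C_matrix P $ a $ b * block_matrix P $ b $ x =
      int (card {y. fst a \<noteq> fst b \<and> R a y \<and> R b y \<and> R b x})" for b
    by (cases "R b x") (simp_all add: C_matrix_nth_card[OF assms] assms)
  then have "(C_matrix P ** block_matrix P) $ a $ x =
      (\<Sum>b\<in>UNIV. int (card {y. fst a \<noteq> fst b \<and> R a y \<and> R b y \<and> R b x}))"
    by (simp add: matrix_matrix_mult_def)
  \<comment> \<open>Summing the counts over \<open>b\<close> counts the disjoint union, that is, the
    pairs of inner nodes of a walk.\<close>
  also have "\<dots> = int (card (SIGMA b:UNIV. {y. fst a \<noteq> fst b \<and> R a y \<and> R b y \<and> R b x}))"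
    by simp
  also have "(SIGMA b:UNIV. {y. fst a \<noteq> fst b \<and> R a y \<and> R b y \<and> R b x}) =
      {(b, y). fst a \<noteq> fst b \<and> R a y \<and> R b y \<and> R b x}"
    by auto
  finally show ?thesis .
qed

lemma mat_triangle_eq_0_iff:
  "A \<triangle> B = 0 \<longleftrightarrow> (\<forall>a x. 2 \<le> A $ a $ x \<longrightarrow> B $ a $ x \<noteq> 0)"
  by (auto simp: vec_eq_iff mat_triangle_def triangle_def)

lemma C_matrix_triangle_iff_no_four_cycle:
  assumes R: "\<And>a x. block_matrix P $ a $ x = of_bool (R a x)"
    and blocks: "\<And>a b x. R a x \<Longrightarrow> R b x \<Longrightarrow> fst a = fst b \<Longrightarrow> a = b"
  shows "C_matrix P \<triangle> 0 = 0 \<longleftrightarrow> \<not> four_cycle R"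
proof -
  have "C_matrix P \<triangle> 0 = 0 \<longleftrightarrow>
      \<not> (\<exists>a b x y. fst a \<noteq> fst b \<and> R a x \<and> R b x \<and> R a y \<and> R b y \<and> x \<noteq> y)"
    unfolding mat_triangle_eq_0_iff C_matrix_nth_card[OF R] by (auto simp: two_le_card_iff)
  also have "\<dots> \<longleftrightarrow> \<not> four_cycle R"
    \<comment> \<open>A 4-cycle only provides \<open>a \<noteq> b\<close>; \<open>blocks\<close>
      turns this into distinct row blocks.\<close>
    unfolding four_cycle_def using blocks by metis
  finally show ?thesis .
qed

lemma C_matrix_mult_triangle_iff_no_six_cycle:
  assumes R: "\<And>a x. block_matrix P $ a $ x = of_bool (R a x)"
    and blocks: "\<And>a b x. R a x \<Longrightarrow> R b x \<Longrightarrow> fst a = fst b \<Longrightarrow> a = b"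
    and no4: "\<not> four_cycle R"
  shows "(C_matrix P ** block_matrix P) \<triangle> block_matrix P = 0 \<longleftrightarrow> \<not> six_cycle R"
proof -
  have no4': "a = b \<or> x = y" if "R a x" "R b x" "R b y" "R a y" for a b x y
    using no4 that unfolding four_cycle_def by blast
  have "(C_matrix P ** block_matrix P) \<triangle> block_matrix P = 0 \<longleftrightarrow>
      \<not> (\<exists>a x b y c z. \<not> R a x \<and> (b, y) \<noteq> (c, z) \<and>
          fst a \<noteq> fst b \<and> R a y \<and> R b y \<and> R b x \<and> fst a \<noteq> fst c \<and> R a z \<and> R c z \<and> R c x)"
    unfolding mat_triangle_eq_0_iff C_matrix_mult_nth_card[OF R] R
    by (simp add: two_le_card_iff) blast
  also have "\<dots> \<longleftrightarrow> \<not> six_cycle R"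
  proof (rule arg_cong[where f = Not], rule iffI)
    assume "\<exists>a x b y c z. \<not> R a x \<and> (b, y) \<noteq> (c, z) \<and>
        fst a \<noteq> fst b \<and> R a y \<and> R b y \<and> R b x \<and> fst a \<noteq> fst c \<and> R a z \<and> R c z \<and> R c x"
    then obtain a x b y c z where nadj: "\<not> R a x" and ne: "(b, y) \<noteq> (c, z)"
      and "fst a \<noteq> fst b" "fst a \<noteq> fst c"
      and adj: "R a y" "R b y" "R b x" "R a z" "R c z" "R c x" by blast
    then have "a \<noteq> b" "a \<noteq> c" by auto
    moreover have "y \<noteq> x" "z \<noteq> x" using adj nadj by auto
    \<comment> \<open>If \<open>b = c\<close>, then \<open>y \<noteq> z\<close> and these are two
      common neighbours of \<open>a\<close> and \<open>b\<close>.\<close>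
    moreover have "b \<noteq> c" using no4'[of a y b z] adj ne \<open>a \<noteq> b\<close> by auto
    \<comment> \<open>If \<open>y = z\<close>, then \<open>b\<close> and \<open>c\<close> share both
      \<open>y\<close> and \<open>x\<close>.\<close>
    moreover have "y \<noteq> z" using no4'[of b y c x] adj \<open>b \<noteq> c\<close> \<open>y \<noteq> x\<close> by auto
    ultimately show "six_cycle R"
      unfolding six_cycle_def using adj by metis
  next
    assume "six_cycle R"
    then obtain a b c x y z
      where "a \<noteq> b" "b \<noteq> c" "a \<noteq> c" "x \<noteq> y"
        and adj: "R a x" "R b x" "R b y" "R c y" "R c z" "R a z"
      unfolding six_cycle_def by blast
    moreover have "fst a \<noteq> fst b" "fst a \<noteq> fst c"
      using blocks adj \<open>a \<noteq> b\<close> \<open>a \<noteq> c\<close> by blast+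
    \<comment> \<open>The opposite nodes \<open>a\<close> and \<open>y\<close> are joined by the
      walks through \<open>x, b\<close> and through \<open>z, c\<close>. Were they adjacent,
      \<open>a\<close> and \<open>b\<close> would share \<open>x\<close> and
      \<open>y\<close>.\<close>
    moreover have "\<not> R a y" using no4'[of a x b y] adj \<open>a \<noteq> b\<close> \<open>x \<noteq> y\<close> by blast
    ultimately show "\<exists>a x b y c z. \<not> R a x \<and> (b, y) \<noteq> (c, z) \<and>
        fst a \<noteq> fst b \<and> R a y \<and> R b y \<and> R b x \<and> fst a \<noteq> fst c \<and> R a z \<and> R c z \<and> R c x"
      by blast
  qed
  finally show ?thesis .
qed

theorem theorem7:
  fixes P :: "'c::finite \<Rightarrow> 'v::finite \<Rightarrow> int ^ 'n::finite ^ 'n"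
    and H :: "int ^ ('v \<times> 'n) ^ ('c \<times> 'n)"
  assumes "CARD('c) \<ge> 2"
    and "\<And>i k. permutation_matrix (P i k)"
    and "H = block_matrix P"
  shows "(girth H > 6 \<longleftrightarrow> C_matrix P \<triangle> 0 = 0 \<and> (C_matrix P ** H) \<triangle> H = 0) \<and>
         (girth H > 6 \<longleftrightarrow>
            (\<forall>k i j. i \<noteq> j \<longrightarrow>
               C_block P i j \<triangle> 0 = 0 \<and>
               (\<Sum>l\<in>UNIV - {i}. C_block P i l ** P l k) \<triangle> P i k = 0))"
proof -
  from assms(2) obtain \<pi> where bij: "\<And>i k. bij (\<pi> i k)"
    and P: "\<And>i k. P i k = (\<chi> r s. if s = \<pi> i k r then 1 else 0)"
    unfolding permutation_matrix_def by metis
  define R where "R a x \<longleftrightarrow> snd x = \<pi> (fst a) (fst x) (snd a)" for a x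
  have R: "block_matrix P $ a $ x = of_bool (R a x)" for a x
    by (simp add: block_matrix_def P R_def)
  \<comment> \<open>Each \<open>\<pi> i k\<close> is injective, so a column of a block has at most
    one nonzero entry.\<close>
  have blocks: "a = b" if "R a x" "R b x" "fst a = fst b" for a b x
    using that bij[THEN bij_is_inj] unfolding R_def by (metis injD prod_eqI)
  have no4: "C_matrix P \<triangle> 0 = 0 \<longleftrightarrow> \<not> four_cycle R"
    by (rule C_matrix_triangle_iff_no_four_cycle[OF R]) (fact blocks)
  \<comment> \<open>The condition suffices, since the first conjunct of the criterion already
    excludes 4-cycles.\<close>
  have no6: "(C_matrix P ** block_matrix P) \<triangle> block_matrix P = 0 \<longleftrightarrow> \<not> six_cycle R"
    if "\<not> four_cycle R"
    by (rule C_matrix_mult_triangle_iff_no_six_cycle[OF R _ that]) (fact blocks)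
  have first: "girth H > 6 \<longleftrightarrow> C_matrix P \<triangle> 0 = 0 \<and> (C_matrix P ** H) \<triangle> H = 0"
    using girth_gt_6_iff[OF R] no4 no6 assms(3) by blast
  \<comment> \<open>The second condition does not mention \<open>j\<close> but stands under the
    guard \<open>i \<noteq> j\<close>; a second row block makes that guard satisfiable for every
    \<open>i\<close>.\<close>
  have other: "\<exists>j. i \<noteq> j" for i :: 'c
  proof (rule ccontr)
    assume "\<nexists>j. i \<noteq> j"
    then have "(UNIV :: 'c set) = {i}" by auto
    then have "CARD('c) = 1" by (metis card.empty card_Suc_eq empty_iff One_nat_def)
    then show False using assms(1) by simp
  qed
  have "C_matrix P \<triangle> 0 = 0 \<and> (C_matrix P ** H) \<triangle> H = 0 \<longleftrightarrow>
      (\<forall>k i j. i \<noteq> j \<longrightarrow> C_block P i j \<triangle> 0 = 0 \<and>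
        (\<Sum>l\<in>UNIV - {i}. C_block P i l ** P l k) \<triangle> P i k = 0)"
    unfolding assms(3) C_matrix_mat_triangle_0_iff C_matrix_mult_mat_triangle_iff
    using other by blast
  with first show ?thesis by blast
qed

end
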